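(* Let $K$ be a field, $n\ge 2$ an integer, $a\in K\setminus\{0,-1\}$, and $L\in\Delta(n,n+1)$. If the infinite matrix $\widetilde{M}:=M(L,a)$ defines a graded twisting map, i.e. if $M:=\widetilde{M}+Y$ is the matrix of a graded twisting map $K[y]\otimes K[x]\to K[x]\otimes K[y]$, then $L\in\mathcal{L}$.
   Context: $\mathbb{N}=\{1,2,\dots\}$, $\mathbb{N}_0=\mathbb{N}\cup\{0\}$. $\Delta(n,n+1)$ is the set of sequences $L=(L_1,L_2,\dots)\in\mathbb{N}^{\mathbb{N}}$ with $L_1=n$ and $L_{j+1}-L_j\in\{n,n+1\}$ for all $j\ge 1$. The set of quasi-balanced sequences is $\mathcal{L}=\{L\in\Delta(n,n+1): L_r-1\le L_j+L_{r-j}\le L_r\text{ for all }0<j<r\}$. For $a\in K\setminus\{0,-1\}$ put $d:=\frac{1}{1+a}$, let $E_j$ ($j\in\mathbb{N}_0$) be the standard basis row vectors, and define the infinite matrix $M(L,a)$ (indexed by $\mathbb{N}_0\times\mathbb{N}_0$) by its rows: $M(L,a)_{j*}=E_0-E_1$ if $j<L_1$; $M(L,a)_{j*}=d^k(E_0-E_1)$ if $L_k<j<L_{k+1}$ for some $k$; $M(L,a)_{j*}=d^kE_0-d^{k-1}E_1+aE_{L_k+1}$ if $j=L_k$ for some $k$. Tensor products are over $K$; $\mu_{K[x]},\mu_{K[y]}$ denote multiplication. $L(K^{\mathbb{N}_0})$ is the algebra of infinite matrices over $K$ indexed by $\mathbb{N}_0\times\mathbb{N}_0$ with finitely many nonzero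 entries in each row; $Y$ is the matrix with $Y_{ij}=\delta_{i+1,j}$. A twisting map is a $K$-linear map $\tau:K[y]\otimes K[x]\to K[x]\otimes K[y]$ such that $\tau(1\otimes f)=f\otimes 1$ and $\tau(y^r\otimes 1)=1\otimes y^r$ for all $f\in K[x]$, $r\ge 0$; $\tau\circ(\mathrm{id}_{K[y]}\otimes\mu_{K[x]})=(\mu_{K[x]}\otimes \mathrm{id}_{K[y]})\circ(\mathrm{id}_{K[x]}\otimes\tau)\circ(\tau\otimes \mathrm{id}_{K[x]})$; and $\tau\circ(\mu_{K[y]}\otimes\mathrm{id}_{K[x]})=(\mathrm{id}_{K[x]}\otimes\mu_{K[y]})\circ(\tau\otimes\mathrm{id}_{K[y]})\circ(\mathrm{id}_{K[y]}\otimes\tau)$. It is graded if $\tau(y^r\otimes x^i)$ lies in the span of $\{x^{r+i-j}\otimes y^j:0\le j\le r+i\}$ for all $r,i$. The matrix of a graded twisting map $\tau$ is the matrix $M\in L(K^{\mathbb{N}_0})$ with $\tau(y^k\otimes x)=\sum_{j=0}^{k+1}M_{kj}\,x^{k+1-j}\otimes y^j$ and $M_{kj}=0$ for $j>k+1$. A matrix $M\in L(K^{\mathbb{N}_0})$ is the matrix of a (unique) graded twisting map if and only if $M_{0j}=\delta_{0j}$, $M_{kj}=0$ for $j>k+1$, and $Y^kM=\sum_{j=0}^{k+1}M_{kj}M^{k+1-j}Y^j$ for all $k\in\mathbb{N}_0$. *)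

theory Defs
  imports Complex_Main "HOL-Library.Poly_Mapping"
begin

section \<open>Vector spaces with a distinguished basis and their tensor products\<close>

text \<open>
  All vector spaces that occur are spaces \<open>'i \<Rightarrow>\<^sub>0 'a\<close> of finitely supported functions, with
  standard basis \<open>bas i\<close>. The polynomial algebras \<open>K[x]\<close> and \<open>K[y]\<close> are both \<open>nat \<Rightarrow>\<^sub>0 'a\<close> with
  the (convolution) product of \<open>HOL-Library.Poly_Mapping\<close>; which variable is meant is determined
  by the position in a tensor product. The tensor product of \<open>'i \<Rightarrow>\<^sub>0 'a\<close> and \<open>'j \<Rightarrow>\<^sub>0 'a\<close> is
  \<open>('i \<times> 'j) \<Rightarrow>\<^sub>0 'a\<close>; lemmas \<open>tensor_add_left\<close> to \<open>tensor_universal\<close> show that it is a tensor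
  product, and \<open>tensor_map_tensor\<close>, \<open>mult_map_tensor\<close>, \<open>assoc_tensor\<close>, \<open>assoc_inv_tensor\<close> give
  the maps below on pure tensors.
\<close>

definition scl :: "'a::field \<Rightarrow> ('i \<Rightarrow>\<^sub>0 'a) \<Rightarrow> ('i \<Rightarrow>\<^sub>0 'a)"
  where "scl c p = Poly_Mapping.map ((*) c) p"

abbreviation bas :: "'i \<Rightarrow> ('i \<Rightarrow>\<^sub>0 'a::field)"
  where "bas i \<equiv> Poly_Mapping.single i 1"

abbreviation is_linear :: "(('i \<Rightarrow>\<^sub>0 'a::field) \<Rightarrow> ('j \<Rightarrow>\<^sub>0 'a)) \<Rightarrow> bool"
  where "is_linear \<equiv> Vector_Spaces.linear scl scl"

definition lin_ext :: "('i \<Rightarrow> ('j \<Rightarrow>\<^sub>0 'a::field)) \<Rightarrow> ('i \<Rightarrow>\<^sub>0 'a) \<Rightarrow> ('j \<Rightarrow>\<^sub>0 'a)"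
  where "lin_ext g p = (\<Sum>i\<in>Poly_Mapping.keys p. scl (Poly_Mapping.lookup p i) (g i))"

definition tensor :: "('i \<Rightarrow>\<^sub>0 'a::field) \<Rightarrow> ('j \<Rightarrow>\<^sub>0 'a) \<Rightarrow> ('i \<times> 'j \<Rightarrow>\<^sub>0 'a)"
    (infixr \<open>\<otimes>\<^sub>t\<close> 75)
  where "u \<otimes>\<^sub>t v = (\<Sum>i\<in>Poly_Mapping.keys u. \<Sum>j\<in>Poly_Mapping.keys v.
           Poly_Mapping.single (i, j) (Poly_Mapping.lookup u i * Poly_Mapping.lookup v j))"

definition tensor_map ::
    "(('i \<Rightarrow>\<^sub>0 'a::field) \<Rightarrow> ('k \<Rightarrow>\<^sub>0 'a)) \<Rightarrow> (('j \<Rightarrow>\<^sub>0 'a) \<Rightarrow> ('l \<Rightarrow>\<^sub>0 'a)) \<Rightarrow>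
     ('i \<times> 'j \<Rightarrow>\<^sub>0 'a) \<Rightarrow> ('k \<times> 'l \<Rightarrow>\<^sub>0 'a)"
    (infixr \<open>\<otimes>\<^sub>m\<close> 75)
  where "f \<otimes>\<^sub>m g = lin_ext (\<lambda>(i, j). f (bas i) \<otimes>\<^sub>t g (bas j))"

definition assoc :: "(('i \<times> 'j) \<times> 'k \<Rightarrow>\<^sub>0 'a::field) \<Rightarrow> ('i \<times> ('j \<times> 'k) \<Rightarrow>\<^sub>0 'a)"
  where "assoc = lin_ext (\<lambda>((i, j), k). bas (i, (j, k)))"

definition assoc_inv :: "('i \<times> ('j \<times> 'k) \<Rightarrow>\<^sub>0 'a::field) \<Rightarrow> (('i \<times> 'j) \<times> 'k \<Rightarrow>\<^sub>0 'a)"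
  where "assoc_inv = lin_ext (\<lambda>(i, (j, k)). bas ((i, j), k))"

definition mult_map :: "(nat \<times> nat \<Rightarrow>\<^sub>0 'a::field) \<Rightarrow> (nat \<Rightarrow>\<^sub>0 'a)"
  where "mult_map = lin_ext (\<lambda>(i, j). bas i * bas j)"


lemma lookup_scl [simp]: "Poly_Mapping.lookup (scl c p) i = c * Poly_Mapping.lookup p i"
  unfolding scl_def by transfer (auto simp: when_def)

lemma vector_space_scl: "vector_space (scl :: 'a::field \<Rightarrow> ('i \<Rightarrow>\<^sub>0 'a) \<Rightarrow> _)"
  by unfold_locales (auto intro!: poly_mapping_eqI simp: lookup_add algebra_simps)

lemma is_linear_iff:
  "is_linear f \<longleftrightarrow> (\<forall>p q. f (p + q) = f p + f q) \<and> (\<forall>c p. f (scl c p) = scl c (f p))"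
  by (simp add: linear_iff_module_hom module_hom_iff module_iff_vector_space vector_space_scl)

lemma is_linear_sum:
  fixes f :: "('i \<Rightarrow>\<^sub>0 'a::field) \<Rightarrow> ('j \<Rightarrow>\<^sub>0 'a)"
  assumes "is_linear f" shows "f (sum g A) = (\<Sum>i\<in>A. f (g i))"
proof -
  have "scl 0 0 = (0 :: 'i \<Rightarrow>\<^sub>0 'a)" by (simp add: poly_mapping_eq_iff fun_eq_iff)
  then have "f 0 = f (scl 0 0)" by simp
  also have "\<dots> = 0" using assms unfolding is_linear_iff
    by (simp add: poly_mapping_eq_iff fun_eq_iff)
  finally have "f 0 = 0" .
  then show ?thesis using assms unfolding is_linear_iff
    by (induction A rule: infinite_finite_induct) auto
qed

lemma lin_ext_superset:
  assumes "finite A" "Poly_Mapping.keys p \<subseteq> A"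
  shows "lin_ext g p = (\<Sum>i\<in>A. scl (Poly_Mapping.lookup p i) (g i))"
  unfolding lin_ext_def using assms
  by (intro sum.mono_neutral_left)
    (auto simp: in_keys_iff poly_mapping_eq_iff fun_eq_iff)

lemma is_linear_lin_ext:
  fixes g :: "'i \<Rightarrow> ('j \<Rightarrow>\<^sub>0 'a::field)"
  shows "is_linear (lin_ext g)"
  unfolding is_linear_iff
proof (intro conjI allI)
  fix p q :: "'i \<Rightarrow>\<^sub>0 'a"
  let ?A = "Poly_Mapping.keys p \<union> Poly_Mapping.keys q"
  have "lin_ext g (p + q) = (\<Sum>i\<in>?A. scl (Poly_Mapping.lookup (p + q) i) (g i))"
    by (rule lin_ext_superset) (use keys_add[of p q] in auto)
  also have "\<dots> = (\<Sum>i\<in>?A. scl (Poly_Mapping.lookup p i) (g i))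
      + (\<Sum>i\<in>?A. scl (Poly_Mapping.lookup q i) (g i))"
    by (simp add: poly_mapping_eq_iff fun_eq_iff lookup_add lookup_sum
        algebra_simps flip: sum.distrib)
  also have "\<dots> = lin_ext g p + lin_ext g q"
    by (subst (1 2) lin_ext_superset[of ?A]) auto
  finally show "lin_ext g (p + q) = lin_ext g p + lin_ext g q" .
next
  fix c and p :: "'i \<Rightarrow>\<^sub>0 'a"
  have "lin_ext g (scl c p) = (\<Sum>i\<in>Poly_Mapping.keys p. scl (Poly_Mapping.lookup (scl c p) i) (g i))"
    by (rule lin_ext_superset) (auto simp: in_keys_iff)
  then show "lin_ext g (scl c p) = scl c (lin_ext g p)"
    by (simp add: lin_ext_def poly_mapping_eq_iff fun_eq_iff lookup_sum
        sum_distrib_left mult.assoc)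
qed

lemma lin_ext_bas [simp]: "lin_ext g (bas i) = g i"
  by (simp add: lin_ext_def poly_mapping_eq_iff fun_eq_iff)

lemma basis_expansion: "p = (\<Sum>i\<in>Poly_Mapping.keys p. scl (Poly_Mapping.lookup p i) (bas i))"
  by (auto simp: poly_mapping_eq_iff fun_eq_iff lookup_sum lookup_single when_def in_keys_iff
      if_distrib[of "(*) _"] cong: if_cong)

lemma is_linear_eqI:
  assumes "is_linear f" "is_linear g" "\<And>i. f (bas i) = g (bas i)"
  shows "f = g"
proof
  fix p
  have "f p = (\<Sum>i\<in>Poly_Mapping.keys p. scl (Poly_Mapping.lookup p i) (f (bas i)))"
    by (subst basis_expansion[of p])
      (use assms(1) in \<open>simp add: is_linear_sum[OF assms(1)] is_linear_iff\<close>)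
  moreover have "g p = (\<Sum>i\<in>Poly_Mapping.keys p. scl (Poly_Mapping.lookup p i) (g (bas i)))"
    by (subst basis_expansion[of p])
      (use assms(2) in \<open>simp add: is_linear_sum[OF assms(2)] is_linear_iff\<close>)
  ultimately show "f p = g p" using assms(3) by simp
qed

lemma lookup_tensor [simp]:
  "Poly_Mapping.lookup (u \<otimes>\<^sub>t v) (i, j) = Poly_Mapping.lookup u i * Poly_Mapping.lookup v j"
proof -
  have "Poly_Mapping.lookup (u \<otimes>\<^sub>t v) (i, j) =
      (\<Sum>i'\<in>Poly_Mapping.keys u. if i' = i then
        (\<Sum>j'\<in>Poly_Mapping.keys v. if j' = j then
          Poly_Mapping.lookup u i * Poly_Mapping.lookup v j else 0) else 0)"
    unfolding tensor_def lookup_sum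
    by (intro sum.cong refl) (auto simp: lookup_single when_def intro!: sum.cong sum.neutral)
  then show ?thesis by (auto simp: in_keys_iff)
qed

lemma tensor_bas [simp]: "bas i \<otimes>\<^sub>t bas j = bas (i, j)"
  by (rule poly_mapping_eqI) (auto simp: lookup_single when_def split: if_splits)

lemma tensor_add_left: "(u + u') \<otimes>\<^sub>t v = u \<otimes>\<^sub>t v + u' \<otimes>\<^sub>t v"
  and tensor_add_right: "u \<otimes>\<^sub>t (v + v') = u \<otimes>\<^sub>t v + u \<otimes>\<^sub>t v'"
  and tensor_scl_left: "scl c u \<otimes>\<^sub>t v = scl c (u \<otimes>\<^sub>t v)"
  and tensor_scl_right: "u \<otimes>\<^sub>t scl c v = scl c (u \<otimes>\<^sub>t v)"
  by (rule poly_mapping_eqI; auto simp: lookup_add algebra_simps)+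

lemma bilinear_eqI:
  fixes B C :: "('i \<Rightarrow>\<^sub>0 'a::field) \<Rightarrow> ('j \<Rightarrow>\<^sub>0 'a) \<Rightarrow> ('k \<Rightarrow>\<^sub>0 'a)"
  assumes "\<And>u. is_linear (B u)" "\<And>v. is_linear (\<lambda>u. B u v)"
    and "\<And>u. is_linear (C u)" "\<And>v. is_linear (\<lambda>u. C u v)"
    and "\<And>i j. B (bas i) (bas j) = C (bas i) (bas j)"
  shows "B u v = C u v"
proof -
  have "B (bas i) = C (bas i)" for i
    by (rule is_linear_eqI) (use assms in auto)
  then have "(\<lambda>u. B u v) = (\<lambda>u. C u v)"
    by (intro is_linear_eqI) (use assms in auto)
  then show ?thesis by metis
qed

lemma tensor_universal:
  fixes B :: "('i \<Rightarrow>\<^sub>0 'a::field) \<Rightarrow> ('j \<Rightarrow>\<^sub>0 'a) \<Rightarrow> ('k \<Rightarrow>\<^sub>0 'a)"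
  assumes "\<And>u. is_linear (B u)" "\<And>v. is_linear (\<lambda>u. B u v)"
  shows "\<exists>!f. is_linear f \<and> (\<forall>u v. f (u \<otimes>\<^sub>t v) = B u v)"
proof (rule ex1I)
  let ?f = "lin_ext (\<lambda>(i, j). B (bas i) (bas j))"
  have lin: "is_linear ?f" by (rule is_linear_lin_ext)
  have "?f (u \<otimes>\<^sub>t v) = B u v" for u v
    by (rule bilinear_eqI[where B = "\<lambda>u v. ?f (u \<otimes>\<^sub>t v)"])
      (use assms lin in \<open>auto simp: is_linear_iff tensor_add_left tensor_add_right
        tensor_scl_left tensor_scl_right\<close>)
  with lin show "is_linear ?f \<and> (\<forall>u v. ?f (u \<otimes>\<^sub>t v) = B u v)" by blast
  fix f assume f: "is_linear f \<and> (\<forall>u v. f (u \<otimes>\<^sub>t v) = B u v)"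
  show "f = ?f"
  proof (rule is_linear_eqI)
    fix p :: "'i \<times> 'j"
    show "f (bas p) = ?f (bas p)"
    proof (cases p)
      case (Pair i j)
      then have "f (bas p) = f (bas i \<otimes>\<^sub>t bas j)" by simp
      also have "\<dots> = B (bas i) (bas j)" using f by blast
      finally show ?thesis using Pair by simp
    qed
  qed (use f lin in auto)
qed

lemma tensor_map_tensor:
  assumes "is_linear f" "is_linear g"
  shows "(f \<otimes>\<^sub>m g) (u \<otimes>\<^sub>t v) = f u \<otimes>\<^sub>t g v"
  by (rule bilinear_eqI[where B = "\<lambda>u v. (f \<otimes>\<^sub>m g) (u \<otimes>\<^sub>t v)"
        and C = "\<lambda>u v. f u \<otimes>\<^sub>t g v"])
    (use assms is_linear_lin_ext[of "\<lambda>(i, j). f (bas i) \<otimes>\<^sub>t g (bas j)"] in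
      \<open>auto simp: is_linear_iff tensor_add_left tensor_add_right
        tensor_scl_left tensor_scl_right tensor_map_def\<close>)

lemma scl_eq_mult: "scl c p = Poly_Mapping.single 0 c * (p :: nat \<Rightarrow>\<^sub>0 'a::field)"
  unfolding scl_def by (rule mult_map_scale_conv_mult)

lemma mult_map_tensor: "mult_map (u \<otimes>\<^sub>t v) = u * v"
  by (rule bilinear_eqI[where B = "\<lambda>u v. mult_map (u \<otimes>\<^sub>t v)"])
    (use is_linear_lin_ext[of "\<lambda>(i, j). bas i * bas j"] in
      \<open>auto simp: is_linear_iff tensor_add_left tensor_add_right
        tensor_scl_left tensor_scl_right mult_map_def scl_eq_mult[symmetric] algebra_simps\<close>,
      auto simp: scl_eq_mult algebra_simps)

lemma lookup_assoc: "Poly_Mapping.lookup (assoc p) (i, (j, k)) = Poly_Mapping.lookup p ((i, j), k)"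
proof -
  have "Poly_Mapping.lookup (assoc p) (i, (j, k)) =
      (\<Sum>q\<in>Poly_Mapping.keys p. if q = ((i, j), k) then Poly_Mapping.lookup p q else 0)"
    unfolding assoc_def lin_ext_def lookup_sum
    by (intro sum.cong refl) (auto simp: lookup_single when_def split: if_splits)
  then show ?thesis by (auto simp: in_keys_iff)
qed

lemma lookup_assoc_inv:
  "Poly_Mapping.lookup (assoc_inv p) ((i, j), k) = Poly_Mapping.lookup p (i, (j, k))"
proof -
  have "Poly_Mapping.lookup (assoc_inv p) ((i, j), k) =
      (\<Sum>q\<in>Poly_Mapping.keys p. if q = (i, (j, k)) then Poly_Mapping.lookup p q else 0)"
    unfolding assoc_inv_def lin_ext_def lookup_sum
    by (intro sum.cong refl) (auto simp: lookup_single when_def split: if_splits)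
  then show ?thesis by (auto simp: in_keys_iff)
qed

lemma assoc_tensor: "assoc ((u \<otimes>\<^sub>t v) \<otimes>\<^sub>t w) = u \<otimes>\<^sub>t (v \<otimes>\<^sub>t w)"
  by (auto simp: poly_mapping_eq_iff fun_eq_iff lookup_assoc mult.assoc)

lemma assoc_inv_tensor: "assoc_inv (u \<otimes>\<^sub>t (v \<otimes>\<^sub>t w)) = (u \<otimes>\<^sub>t v) \<otimes>\<^sub>t w"
  by (auto simp: poly_mapping_eq_iff fun_eq_iff lookup_assoc_inv mult.assoc)


section \<open>Twisting maps\<close>

text \<open>The variable \<open>x\<close> of \<open>K[x]\<close>, respectively \<open>y\<close> of \<open>K[y]\<close>.\<close>

definition var :: "nat \<Rightarrow>\<^sub>0 'a::field"
  where "var = Poly_Mapping.single 1 1"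

text \<open>Maps \<open>K[y] \<otimes> K[x] \<rightarrow> K[x] \<otimes> K[y]\<close>: in the domain the first index is the exponent of \<open>y\<close>,
  in the codomain the first index is the exponent of \<open>x\<close>. The canonical identifications
  \<open>(U \<otimes> V) \<otimes> W = U \<otimes> (V \<otimes> W)\<close> are written out.\<close>

definition twisting_map :: "((nat \<times> nat \<Rightarrow>\<^sub>0 'a::field) \<Rightarrow> (nat \<times> nat \<Rightarrow>\<^sub>0 'a)) \<Rightarrow> bool"
  where "twisting_map \<tau> \<longleftrightarrow>
    is_linear \<tau> \<and>
    (\<forall>f. \<tau> (1 \<otimes>\<^sub>t f) = f \<otimes>\<^sub>t 1) \<and>
    (\<forall>r. \<tau> (var ^ r \<otimes>\<^sub>t 1) = 1 \<otimes>\<^sub>t var ^ r) \<and>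
    \<tau> \<circ> (id \<otimes>\<^sub>m mult_map) =
      (mult_map \<otimes>\<^sub>m id) \<circ> assoc_inv \<circ> (id \<otimes>\<^sub>m \<tau>) \<circ> assoc \<circ> (\<tau> \<otimes>\<^sub>m id) \<circ> assoc_inv \<and>
    \<tau> \<circ> (mult_map \<otimes>\<^sub>m id) =
      (id \<otimes>\<^sub>m mult_map) \<circ> assoc \<circ> (\<tau> \<otimes>\<^sub>m id) \<circ> assoc_inv \<circ> (id \<otimes>\<^sub>m \<tau>) \<circ> assoc"

definition graded_map :: "((nat \<times> nat \<Rightarrow>\<^sub>0 'a::field) \<Rightarrow> (nat \<times> nat \<Rightarrow>\<^sub>0 'a)) \<Rightarrow> bool"
  where "graded_map \<tau> \<longleftrightarrow>
    (\<forall>r i. \<tau> (var ^ r \<otimes>\<^sub>t var ^ i) \<in>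
       module.span scl {var ^ (r + i - j) \<otimes>\<^sub>t var ^ j | j. j \<le> r + i})"

definition graded_twisting_map ::
    "((nat \<times> nat \<Rightarrow>\<^sub>0 'a::field) \<Rightarrow> (nat \<times> nat \<Rightarrow>\<^sub>0 'a)) \<Rightarrow> bool"
  where "graded_twisting_map \<tau> \<longleftrightarrow> twisting_map \<tau> \<and> graded_map \<tau>"


section \<open>Infinite matrices\<close>

type_synonym 'a inf_matrix = "nat \<Rightarrow> nat \<Rightarrow> 'a"

definition row_finite :: "'a::field inf_matrix \<Rightarrow> bool"
  where "row_finite M \<longleftrightarrow> (\<forall>i. finite {j. M i j \<noteq> 0})"

definition shift_matrix :: "'a::field inf_matrix"
  where "shift_matrix = (\<lambda>i j. if i + 1 = j then 1 else 0)"

definition is_matrix_of_map ::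
    "'a::field inf_matrix \<Rightarrow> ((nat \<times> nat \<Rightarrow>\<^sub>0 'a) \<Rightarrow> (nat \<times> nat \<Rightarrow>\<^sub>0 'a)) \<Rightarrow> bool"
  where "is_matrix_of_map M \<tau> \<longleftrightarrow>
    row_finite M \<and>
    (\<forall>k. \<tau> (var ^ k \<otimes>\<^sub>t var) = (\<Sum>j=0..k+1. scl (M k j) (var ^ (k + 1 - j) \<otimes>\<^sub>t var ^ j))) \<and>
    (\<forall>k j. j > k + 1 \<longrightarrow> M k j = 0)"

definition is_graded_twisting_matrix :: "'a::field inf_matrix \<Rightarrow> bool"
  where "is_graded_twisting_matrix M \<longleftrightarrow> (\<exists>\<tau>. graded_twisting_map \<tau> \<and> is_matrix_of_map M \<tau>)"


section \<open>Quasi-balanced sequences and the matrices \<open>M(L,a)\<close>\<close>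

text \<open>A sequence \<open>(L\<^sub>1, L\<^sub>2, \<dots>)\<close> is a function on \<open>nat\<close> whose value at \<open>0\<close> is never used.
  \<open>Delta n\<close> is \<open>\<Delta>(n,n+1)\<close>; for \<open>n \<ge> 1\<close> its members have positive values at all positive
  indices.\<close>

definition Delta :: "nat \<Rightarrow> (nat \<Rightarrow> nat) set"
  where "Delta n = {L. L 1 = n \<and> (\<forall>j\<ge>1. int (L (j + 1)) - int (L j) \<in> {int n, int n + 1})}"

definition quasi_balanced :: "nat \<Rightarrow> (nat \<Rightarrow> nat) set"
  where "quasi_balanced n =
    {L \<in> Delta n. \<forall>r j. 0 < j \<and> j < r \<longrightarrow>
       int (L r) - 1 \<le> int (L j + L (r - j)) \<and> L j + L (r - j) \<le> L r}"

definition unit_row :: "nat \<Rightarrow> nat \<Rightarrow> 'a::field"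
  where "unit_row j = (\<lambda>i. if i = j then 1 else 0)"

text \<open>For \<open>L \<in> Delta n\<close> with \<open>n \<ge> 1\<close> the three cases are exhaustive and mutually exclusive and the
  \<open>k\<close> in the last two is unique, see \<open>seq_matrix_rows\<close>.\<close>

definition seq_matrix :: "(nat \<Rightarrow> nat) \<Rightarrow> 'a::field \<Rightarrow> 'a inf_matrix"
  where "seq_matrix L a = (\<lambda>j.
    let d = 1 / (1 + a) in
    if j < L 1 then (\<lambda>i. unit_row 0 i - unit_row 1 i)
    else if \<exists>k\<ge>1. L k < j \<and> j < L (k + 1) then
      (let k = (THE k. 1 \<le> k \<and> L k < j \<and> j < L (k + 1))
       in (\<lambda>i. d ^ k * (unit_row 0 i - unit_row 1 i)))
    else
      (let k = (THE k. 1 \<le> k \<and> j = L k)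
       in (\<lambda>i. d ^ k * unit_row 0 i - d ^ (k - 1) * unit_row 1 i + a * unit_row (L k + 1) i)))"

lemma Delta_less:
  assumes "L \<in> Delta n" "n \<ge> 1" "1 \<le> i" "i < j"
  shows "L i < L j"
proof -
  have step: "L m < L (Suc m)" if "m \<ge> 1" for m
    using assms(1,2) that unfolding Delta_def by fastforce
  show ?thesis using assms(4,3)
  proof (induction rule: less_Suc_induct)
    case (1 i) then show ?case using step by blast
  next
    case (2 i j k) then show ?case by linarith
  qed
qed

lemma seq_matrix_rows:
  assumes L: "L \<in> Delta n" and n: "n \<ge> 1"
  shows "j < L 1 \<Longrightarrow> seq_matrix L a j = (\<lambda>i. unit_row 0 i - unit_row 1 i)"
    and "1 \<le> k \<Longrightarrow> L k < j \<Longrightarrow> j < L (k + 1) \<Longrightarrow>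
      seq_matrix L a j = (\<lambda>i. (1 / (1 + a)) ^ k * (unit_row 0 i - unit_row 1 i))"
    and "1 \<le> k \<Longrightarrow> j = L k \<Longrightarrow>
      seq_matrix L a j = (\<lambda>i. (1 / (1 + a)) ^ k * unit_row 0 i
        - (1 / (1 + a)) ^ (k - 1) * unit_row 1 i + a * unit_row (L k + 1) i)"
    and "j < L 1 \<or> (\<exists>k\<ge>1. L k < j \<and> j < L (k + 1)) \<or> (\<exists>k\<ge>1. j = L k)"
proof -
  have less: "L i < L j \<longleftrightarrow> i < j" if "1 \<le> i" "1 \<le> j" for i j
    using Delta_less[OF L n] that by (metis less_asym less_irrefl nat_neq_iff)
  show "seq_matrix L a j = (\<lambda>i. unit_row 0 i - unit_row 1 i)" if "j < L 1"
    using that by (simp add: seq_matrix_def)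
  show "seq_matrix L a j = (\<lambda>i. (1 / (1 + a)) ^ k * (unit_row 0 i - unit_row 1 i))"
    if k: "1 \<le> k" "L k < j" "j < L (k + 1)"
  proof -
    have "k' = k" if "1 \<le> k'" "L k' < j" "j < L (k' + 1)" for k'
      using less[of k "k' + 1"] less[of k' "k + 1"] that k by linarith
    then have "(THE k. 1 \<le> k \<and> L k < j \<and> j < L (k + 1)) = k" using k by blast
    moreover have "\<not> j < L 1" using less[of k 1] k by linarith
    ultimately show ?thesis using k by (auto simp: seq_matrix_def Let_def)
  qed
  show "seq_matrix L a j = (\<lambda>i. (1 / (1 + a)) ^ k * unit_row 0 i
      - (1 / (1 + a)) ^ (k - 1) * unit_row 1 i + a * unit_row (L k + 1) i)"
    if k: "1 \<le> k" "j = L k"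
  proof -
    have "k' = k" if "1 \<le> k'" "j = L k'" for k'
      using less[of k k'] less[of k' k] that k by linarith
    then have "(THE k. 1 \<le> k \<and> j = L k) = k" using k by blast
    moreover have "\<not> j < L 1" using less[of k 1] k by linarith
    moreover have "\<not> (\<exists>k\<ge>1. L k < j \<and> j < L (k + 1))"
      using less k by (metis Suc_eq_plus1 le_add2 not_less_eq)
    ultimately show ?thesis using k unfolding seq_matrix_def Let_def by (simp only: if_False)
  qed
  show "j < L 1 \<or> (\<exists>k\<ge>1. L k < j \<and> j < L (k + 1)) \<or> (\<exists>k\<ge>1. j = L k)"
  proof (induction j)
    case 0 then show ?case using L n by (auto simp: Delta_def)
  next
    case (Suc j)
    consider "j < L 1" | k where "k \<ge> 1" "L k < j" "j < L (k + 1)" | k where "k \<ge> 1" "j = L k"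
      using Suc by blast
    then show ?case
    proof cases
      case 1 then show ?thesis by (cases "Suc j = L 1") auto
    next
      case 2
      have "1 \<le> k + 1" by simp
      moreover have "Suc j = L (k + 1) \<or> L k < Suc j \<and> Suc j < L (k + 1)" using 2 by linarith
      ultimately show ?thesis using 2(1) by blast
    next
      case 3
      have "L k < L (k + 1)" using less 3(1) by simp
      then have "Suc j = L (k + 1) \<or> L k < Suc j \<and> Suc j < L (k + 1)" using 3 by linarith
      moreover have "1 \<le> k + 1" by simp
      ultimately show ?thesis using 3(1) by blast
    qed
  qed
qed

end

theory Submission
  imports Defs
begin

text \<open>
  Write \<open>c = 1 + a\<close> and let \<open>K i\<close> be the number of indices \<open>m \<ge> 1\<close> with \<open>L m < i\<close>. The proof sees
  only the part of the twisting map that survives when \<open>x\<close> is set to \<open>0\<close>: modulo \<open>x\<close>, the element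
  \<open>y\<^sup>q x\<close> becomes \<open>M\<^bsub>q,q+1\<^esub> y\<^bsup>q+1\<^esup>\<close>, so \<open>y\<^sup>i x\<^sup>m\<close> becomes the product of \<open>m\<close> consecutive superdiagonal
  entries times \<open>y\<^bsup>i+m\<^esup>\<close>. Computing \<open>y\<^bsup>i+k\<^esup> x = y\<^sup>i (y\<^sup>k x)\<close> in two ways gives a scalar identity between
  the \<open>k\<close>-th row of \<open>M\<close> and its superdiagonal (\<open>graded_twisting_matrix_superdiagonal\<close>).

  For \<open>M = M(L,a) + Y\<close> the superdiagonal entry in row \<open>t \<ge> 1\<close> is \<open>c\<close> if \<open>t\<close> is a value of \<open>L\<close> and
  \<open>1\<close> otherwise, i.e. \<open>c\<close> to the power \<open>K (t + 1) - K t\<close>; products of consecutive entries telescope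
  to \<open>c\<close> to the power \<open>K (i + m) - K i\<close>. With the defect \<open>\<delta> k = K (i + k) - K i - K k\<close> the identity reads,
  for \<open>i, k \<ge> 1\<close>,
  \<open>c\<^bsup>K(i+k+1) - K(i+k)\<^esup> = c\<^bsup>\<delta>(k+1)\<^esup> - c\<^bsup>\<delta> k\<^esup> + c\<^bsup>K(k+1) - K k\<^esup>\<close>. From one \<open>k\<close> to the next the defect changes by
  at most \<open>1\<close>. A step from \<open>1\<close> to \<open>2\<close> or from \<open>0\<close> to \<open>-1\<close> would turn the identity into
  \<open>(c - 1)\<^sup>2 = 0\<close>, which is impossible because \<open>a \<noteq> 0\<close>; and
  \<open>\<delta> 0 = 0\<close>, \<open>\<delta> 1 \<in> {0, 1}\<close> because \<open>K 0 = K 1 = 0\<close>. Hence \<open>K\<close> is additive up to a defect in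
  \<open>{0, 1}\<close> (\<open>count_below_almost_additive\<close>). Since \<open>r \<le> K i\<close> holds exactly if \<open>L r < i\<close>, this
  translates into the two inequalities that define quasi-balanced sequences.
\<close>

section \<open>A numerical identity for graded twisting maps\<close>

lemma var_power: "(var :: nat \<Rightarrow>\<^sub>0 'a::field) ^ r = bas r"
proof (induction r)
  case (Suc r)
  then show ?case by (simp add: var_def mult_single)
qed simp

lemma is_linear_comp:
  assumes "is_linear g" "is_linear f" shows "is_linear (\<lambda>p. g (f p))"
  using assms by (simp add: is_linear_iff)

lemma is_linear_scl_sum:
  assumes "is_linear f"
  shows "f (\<Sum>i\<in>A. scl (c i) (g i)) = (\<Sum>i\<in>A. scl (c i) (f (g i)))"
  using assms by (simp add: is_linear_sum is_linear_iff)

lemma tensor_sum_right: "u \<otimes>\<^sub>t (\<Sum>i\<in>A. scl (c i) (g i)) = (\<Sum>i\<in>A. scl (c i) (u \<otimes>\<^sub>t g i))"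
  by (rule is_linear_scl_sum) (simp add: is_linear_iff tensor_add_right tensor_scl_right)

lemma is_linear_tensor_map: "is_linear (f \<otimes>\<^sub>m g)"
  unfolding tensor_map_def by (rule is_linear_lin_ext)

lemma is_linear_assoc: "is_linear assoc"
  unfolding assoc_def by (rule is_linear_lin_ext)

lemma is_linear_assoc_inv: "is_linear assoc_inv"
  unfolding assoc_inv_def by (rule is_linear_lin_ext)

lemma is_linear_id: "is_linear id"
  by (simp add: is_linear_iff)

lemma is_linear_mult_map: "is_linear mult_map"
  unfolding mult_map_def by (rule is_linear_lin_ext)

text \<open>
  Reduction modulo \<open>x\<close>: the first index in the codomain of a twisting map is the exponent of \<open>x\<close>.
\<close>

definition x_to_0 :: "(nat \<times> nat \<Rightarrow>\<^sub>0 'a::field) \<Rightarrow> (nat \<Rightarrow>\<^sub>0 'a)"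
  where "x_to_0 = lin_ext (\<lambda>(p, q). if p = 0 then bas q else 0)"

lemma is_linear_x_to_0: "is_linear x_to_0"
  unfolding x_to_0_def by (rule is_linear_lin_ext)

lemma x_to_0_bas: "x_to_0 (bas (p, q)) = (if p = 0 then bas q else 0)"
  by (simp add: x_to_0_def)

lemma scl_zero_right [simp]: "scl c (0 :: 'i \<Rightarrow>\<^sub>0 'a::field) = 0"
  by (simp add: poly_mapping_eq_iff fun_eq_iff)

lemma scl_scl [simp]: "scl c (scl c' p) = scl (c * c') p"
  by (simp add: poly_mapping_eq_iff fun_eq_iff mult.assoc)

lemma scl_mult_left: "scl c p * q = scl c (p * q :: nat \<Rightarrow>\<^sub>0 'a::field)"
  by (simp add: scl_eq_mult mult.assoc)

text \<open>
  The next two lemmas describe what is left of the outer multiplications in the two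
  multiplicativity axioms once \<open>x\<close> is \<open>0\<close>: substitution is multiplicative in \<open>x\<close>, with value \<open>0\<close>
  on positive powers, and linear over \<open>K[y]\<close>.
\<close>

lemma x_to_0_mult_left:
  fixes w :: "nat \<times> nat \<Rightarrow>\<^sub>0 'a::field"
  shows "x_to_0 ((mult_map \<otimes>\<^sub>m id) (assoc_inv (bas p \<otimes>\<^sub>t w))) = (if p = 0 then x_to_0 w else 0)"
proof -
  have lin: "is_linear (\<lambda>w :: nat \<times> nat \<Rightarrow>\<^sub>0 'a. bas p \<otimes>\<^sub>t w)"
    by (simp add: is_linear_iff tensor_add_right tensor_scl_right)
  have "(\<lambda>w :: nat \<times> nat \<Rightarrow>\<^sub>0 'a. x_to_0 ((mult_map \<otimes>\<^sub>m id) (assoc_inv (bas p \<otimes>\<^sub>t w)))) =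
      (\<lambda>w. if p = 0 then x_to_0 w else 0)"
  proof (rule is_linear_eqI)
    show "is_linear (\<lambda>w :: nat \<times> nat \<Rightarrow>\<^sub>0 'a. x_to_0 ((mult_map \<otimes>\<^sub>m id) (assoc_inv (bas p \<otimes>\<^sub>t w))))"
      by (intro is_linear_comp[OF is_linear_x_to_0] is_linear_comp[OF is_linear_tensor_map]
          is_linear_comp[OF is_linear_assoc_inv] lin)
    show "is_linear (\<lambda>w :: nat \<times> nat \<Rightarrow>\<^sub>0 'a. if p = 0 then x_to_0 w else 0)"
      by (cases "p = 0") (simp_all add: is_linear_x_to_0, simp add: is_linear_iff)
    fix st :: "nat \<times> nat"
    obtain s t where st: "st = (s, t)" by fastforce
    have "(mult_map \<otimes>\<^sub>m id) (assoc_inv (bas p \<otimes>\<^sub>t bas (s, t))) = (bas (p + s, t) :: nat \<times> nat \<Rightarrow>\<^sub>0 'a)"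
      by (simp add: assoc_inv_tensor tensor_map_tensor is_linear_mult_map is_linear_id
          mult_map_tensor mult_single flip: tensor_bas)
    then show "x_to_0 ((mult_map \<otimes>\<^sub>m id) (assoc_inv (bas p \<otimes>\<^sub>t bas st))) =
        (if p = 0 then x_to_0 (bas st) else (0 :: nat \<Rightarrow>\<^sub>0 'a))"
      by (simp add: st x_to_0_bas)
  qed
  then show ?thesis by metis
qed

lemma x_to_0_mult_right:
  fixes w :: "nat \<times> nat \<Rightarrow>\<^sub>0 'a::field"
  shows "x_to_0 ((id \<otimes>\<^sub>m mult_map) (assoc (w \<otimes>\<^sub>t bas j))) = x_to_0 w * bas j"
proof -
  have "(\<lambda>w :: nat \<times> nat \<Rightarrow>\<^sub>0 'a. x_to_0 ((id \<otimes>\<^sub>m mult_map) (assoc (w \<otimes>\<^sub>t bas j)))) = (\<lambda>w. x_to_0 w * bas j)"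
  proof (rule is_linear_eqI)
    have "is_linear (\<lambda>w :: nat \<times> nat \<Rightarrow>\<^sub>0 'a. w \<otimes>\<^sub>t bas j)"
      by (simp add: is_linear_iff tensor_add_left tensor_scl_left)
    then show "is_linear (\<lambda>w :: nat \<times> nat \<Rightarrow>\<^sub>0 'a. x_to_0 ((id \<otimes>\<^sub>m mult_map) (assoc (w \<otimes>\<^sub>t bas j))))"
      by (intro is_linear_comp[OF is_linear_x_to_0] is_linear_comp[OF is_linear_tensor_map]
          is_linear_comp[OF is_linear_assoc])
    have "is_linear (\<lambda>u :: nat \<Rightarrow>\<^sub>0 'a. u * bas j)"
      by (simp add: is_linear_iff distrib_right scl_mult_left)
    then show "is_linear (\<lambda>w :: nat \<times> nat \<Rightarrow>\<^sub>0 'a. x_to_0 w * bas j)"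
      by (rule is_linear_comp[OF _ is_linear_x_to_0])
    fix st :: "nat \<times> nat"
    obtain s t where st: "st = (s, t)" by fastforce
    have "(id \<otimes>\<^sub>m mult_map) (assoc (bas (s, t) \<otimes>\<^sub>t bas j)) = (bas (s, t + j) :: nat \<times> nat \<Rightarrow>\<^sub>0 'a)"
      by (simp add: assoc_tensor tensor_map_tensor is_linear_mult_map is_linear_id
          mult_map_tensor mult_single flip: tensor_bas)
    then show "x_to_0 ((id \<otimes>\<^sub>m mult_map) (assoc (bas st \<otimes>\<^sub>t bas j))) = x_to_0 (bas st) * (bas j :: nat \<Rightarrow>\<^sub>0 'a)"
      by (simp add: st x_to_0_bas mult_single)
  qed
  then show ?thesis by metis
qed

text \<open>
  Modulo \<open>x\<close>, right multiplication by \<open>x\<close> is the weighted shift \<open>y\<^sup>q \<mapsto> M\<^bsub>q,q+1\<^esub> y\<^bsup>q+1\<^esup>\<close>. Multiplicativity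
  in \<open>x\<close> makes \<open>x\<^sup>m\<close> act by the \<open>m\<close>-th power of this shift. Multiplicativity in \<open>y\<close> expresses the
  action of \<open>x\<close> on \<open>y\<^bsup>i+k\<^esup>\<close> by moving \<open>x\<close> first past \<open>y\<^sup>k\<close>, which creates the \<open>k\<close>-th row of the matrix,
  and then the resulting powers of \<open>x\<close> past \<open>y\<^sup>i\<close>.
\<close>

theorem graded_twisting_matrix_superdiagonal:
  fixes M :: "'a::field inf_matrix"
  assumes "is_graded_twisting_matrix M"
  shows "M (i + k) (i + k + 1) = (\<Sum>j\<le>k + 1. M k j * (\<Prod>t<k + 1 - j. M (i + t) (i + t + 1)))"
proof -
  obtain \<tau> where tw: "twisting_map \<tau>" and mat: "is_matrix_of_map M \<tau>"
    using assms by (auto simp: is_graded_twisting_matrix_def graded_twisting_map_def)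
  have lin: "is_linear \<tau>" using tw by (simp add: twisting_map_def)
  have ax1: "\<tau> ((id \<otimes>\<^sub>m mult_map) u) =
      (mult_map \<otimes>\<^sub>m id) (assoc_inv ((id \<otimes>\<^sub>m \<tau>) (assoc ((\<tau> \<otimes>\<^sub>m id) (assoc_inv u)))))" for u
    using tw unfolding twisting_map_def o_def by meson
  have ax2: "\<tau> ((mult_map \<otimes>\<^sub>m id) u) =
      (id \<otimes>\<^sub>m mult_map) (assoc ((\<tau> \<otimes>\<^sub>m id) (assoc_inv ((id \<otimes>\<^sub>m \<tau>) (assoc u)))))" for u
    using tw unfolding twisting_map_def o_def by meson
  have \<tau>1: "\<tau> (bas q \<otimes>\<^sub>t bas 1) = (\<Sum>j\<le>q + 1. scl (M q j) (bas (q + 1 - j) \<otimes>\<^sub>t bas j))" for q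
    using mat unfolding is_matrix_of_map_def
    by (metis (no_types, lifting) var_power power_one_right atLeast0AtMost sum.cong)
  define lam where "lam q = M q (q + 1)" for q
  have x0\<tau>: "x_to_0 (\<tau> (bas q \<otimes>\<^sub>t bas 1)) = scl (lam q) (bas (q + 1))" for q
  proof -
    have "x_to_0 (\<tau> (bas q \<otimes>\<^sub>t bas 1)) =
        (\<Sum>j\<le>q + 1. scl (M q j) (x_to_0 (bas (q + 1 - j, j))))"
      by (simp only: \<tau>1 is_linear_scl_sum[OF is_linear_x_to_0]) (simp only: tensor_bas)
    also have "\<dots> = (\<Sum>j\<le>q + 1. if j = q + 1 then scl (M q j) (bas j) else 0)"
      by (rule sum.cong) (auto simp: x_to_0_bas)
    finally show ?thesis by (simp add: lam_def)
  qed
  define shift where "shift = lin_ext (\<lambda>q. scl (lam q) (bas (q + 1)))"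
  have lin_shift: "is_linear shift" unfolding shift_def by (rule is_linear_lin_ext)
  \<comment> \<open>The right-hand side of the first axiom at \<open>bas i \<otimes>\<^sub>t bas m \<otimes>\<^sub>t bas 1\<close> is the left-hand side here,
    for \<open>w = \<tau> (bas i \<otimes>\<^sub>t bas m)\<close>; modulo \<open>x\<close> it depends on \<open>w\<close> modulo \<open>x\<close> only.\<close>
  have step: "x_to_0 ((mult_map \<otimes>\<^sub>m id) (assoc_inv ((id \<otimes>\<^sub>m \<tau>) (assoc (w \<otimes>\<^sub>t bas 1))))) =
      shift (x_to_0 w)" for w
  proof -
    have "(\<lambda>w :: nat \<times> nat \<Rightarrow>\<^sub>0 'a. x_to_0 ((mult_map \<otimes>\<^sub>m id) (assoc_inv ((id \<otimes>\<^sub>m \<tau>) (assoc (w \<otimes>\<^sub>t bas 1)))))) =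
        (\<lambda>w. shift (x_to_0 w))"
    proof (rule is_linear_eqI)
      have "is_linear (\<lambda>w. w \<otimes>\<^sub>t bas (1::nat))"
        by (simp add: is_linear_iff tensor_add_left tensor_scl_left)
      then show "is_linear (\<lambda>w. x_to_0
          ((mult_map \<otimes>\<^sub>m id) (assoc_inv ((id \<otimes>\<^sub>m \<tau>) (assoc (w \<otimes>\<^sub>t bas 1))))))"
        by (intro is_linear_comp[OF is_linear_x_to_0] is_linear_comp[OF is_linear_tensor_map]
            is_linear_comp[OF is_linear_assoc] is_linear_comp[OF is_linear_assoc_inv])
      show "is_linear (\<lambda>w. shift (x_to_0 w))"
        by (rule is_linear_comp[OF lin_shift is_linear_x_to_0])
      fix st :: "nat \<times> nat"
      obtain s t where st: "st = (s, t)" by fastforce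
      have "(id \<otimes>\<^sub>m \<tau>) (assoc ((bas s \<otimes>\<^sub>t bas t) \<otimes>\<^sub>t bas 1)) = bas s \<otimes>\<^sub>t \<tau> (bas t \<otimes>\<^sub>t bas 1)"
        by (simp only: assoc_tensor tensor_map_tensor[OF is_linear_id lin] id_apply)
      moreover have "shift (bas t) = scl (lam t) (bas (t + 1))"
        unfolding shift_def by simp
      moreover have "shift 0 = 0"
        using is_linear_sum[OF lin_shift, of "\<lambda>_. 0" "{}"] by simp
      ultimately show "x_to_0 ((mult_map \<otimes>\<^sub>m id) (assoc_inv ((id \<otimes>\<^sub>m \<tau>) (assoc (bas st \<otimes>\<^sub>t bas 1)))))
          = shift (x_to_0 (bas st))"
        unfolding st x_to_0_bas unfolding tensor_bas[of s t, symmetric]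
        by (simp only: x_to_0_mult_left x0\<tau> split: if_split) simp
    qed
    then show ?thesis by metis
  qed
  have powers: "x_to_0 (\<tau> (bas i \<otimes>\<^sub>t bas m)) = scl (\<Prod>t<m. lam (i + t)) (bas (i + m))" for m
  proof (induction m)
    case 0
    have eq: "\<tau> (bas i \<otimes>\<^sub>t bas 0) = bas 0 \<otimes>\<^sub>t bas i"
      using tw unfolding twisting_map_def by (metis var_power single_one)
    show ?case unfolding eq unfolding tensor_bas by (simp add: x_to_0_bas poly_mapping_eq_iff fun_eq_iff)
  next
    case (Suc m)
    have "(bas i :: nat \<Rightarrow>\<^sub>0 'a) \<otimes>\<^sub>t bas (Suc m) = (id \<otimes>\<^sub>m mult_map) (bas i \<otimes>\<^sub>t bas m \<otimes>\<^sub>t bas 1)"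
      by (simp only: tensor_map_tensor[OF is_linear_id is_linear_mult_map] mult_map_tensor)
        (simp add: mult_single)
    then have "x_to_0 (\<tau> (bas i \<otimes>\<^sub>t bas (Suc m))) = shift (x_to_0 (\<tau> (bas i \<otimes>\<^sub>t bas m)))"
      by (simp only: ax1 assoc_inv_tensor tensor_map_tensor[OF lin is_linear_id] id_apply step)
    also have "\<dots> = scl (\<Prod>t<m. lam (i + t)) (shift (bas (i + m)))"
      using lin_shift unfolding Suc is_linear_iff by blast
    also have "\<dots> = scl (\<Prod>t<Suc m. lam (i + t)) (bas (i + Suc m))"
      by (simp add: shift_def)
    finally show ?case .
  qed
  have "(bas (i + k) :: nat \<Rightarrow>\<^sub>0 'a) \<otimes>\<^sub>t bas 1 = (mult_map \<otimes>\<^sub>m id) ((bas i \<otimes>\<^sub>t bas k) \<otimes>\<^sub>t bas (1::nat))"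
    by (simp only: tensor_map_tensor[OF is_linear_mult_map is_linear_id] mult_map_tensor)
      (simp add: mult_single)
  then have "x_to_0 (\<tau> (bas (i + k) \<otimes>\<^sub>t bas 1)) =
      x_to_0 ((id \<otimes>\<^sub>m mult_map) (assoc ((\<tau> \<otimes>\<^sub>m id) (assoc_inv (bas i \<otimes>\<^sub>t \<tau> (bas k \<otimes>\<^sub>t bas 1))))))"
    by (simp only: ax2 assoc_tensor tensor_map_tensor[OF is_linear_id lin] id_apply)
  also have "\<dots> = (\<Sum>j\<le>k + 1. scl (M k j) (x_to_0 (\<tau> (bas i \<otimes>\<^sub>t bas (k + 1 - j))) * bas j))"
    by (simp only: \<tau>1 tensor_sum_right is_linear_scl_sum[OF is_linear_assoc_inv]
        is_linear_scl_sum[OF is_linear_tensor_map] is_linear_scl_sum[OF is_linear_assoc]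
        is_linear_scl_sum[OF is_linear_x_to_0] assoc_inv_tensor
        tensor_map_tensor[OF lin is_linear_id] id_apply x_to_0_mult_right)
  also have "\<dots> = (\<Sum>j\<le>k + 1. scl (M k j * (\<Prod>t<k + 1 - j. lam (i + t))) (bas (i + k + 1)))"
  proof (rule sum.cong)
    fix j assume "j \<in> {..k + 1}"
    then have "scl c (bas (i + (k + 1 - j))) * bas j = scl c (bas (i + k + 1))" for c :: 'a
      by (simp add: scl_eq_mult mult_single)
    then show "scl (M k j) (x_to_0 (\<tau> (bas i \<otimes>\<^sub>t bas (k + 1 - j))) * bas j) =
        scl (M k j * (\<Prod>t<k + 1 - j. lam (i + t))) (bas (i + k + 1))"
      by (simp only: powers scl_scl)
  qed simp
  finally have "Poly_Mapping.lookup (scl (lam (i + k)) (bas (i + k + 1))) (i + k + 1) =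
      Poly_Mapping.lookup (\<Sum>j\<le>k + 1. scl (M k j * (\<Prod>t<k + 1 - j. lam (i + t)))
        (bas (i + k + 1))) (i + k + 1)"
    by (simp only: x0\<tau>)
  then show ?thesis by (simp only: lookup_sum lookup_scl) (simp add: lam_def)
qed


section \<open>The counting function of a sequence\<close>

definition count_below :: "(nat \<Rightarrow> nat) \<Rightarrow> nat \<Rightarrow> nat"
  where "count_below L i = card {m. 1 \<le> m \<and> L m < i}"

text \<open>
  Counting function and sequence form a Galois connection, because the sequence is strictly
  increasing and hence the indices counted are an initial segment.
\<close>

lemma le_count_below_iff:
  assumes L: "L \<in> Delta n" and n: "n \<ge> 1" and r: "r \<ge> 1"
  shows "r \<le> count_below L i \<longleftrightarrow> L r < i"
proof -
  have mono: "L p \<le> L q" if "1 \<le> p" "p \<le> q" for p q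
    using Delta_less[OF L n, of p q] that by (cases "p = q") auto
  have ge: "m \<le> L m" if "1 \<le> m" for m
    using that
  proof (induction m rule: nat_induct_at_least)
    case base
    then show ?case using L n by (simp add: Delta_def)
  next
    case (Suc m)
    then show ?case using Delta_less[OF L n, of m "Suc m"] by simp
  qed
  have fin: "finite {m. 1 \<le> m \<and> L m < i}"
    by (rule finite_subset[of _ "{..<i}"]) (use ge in fastforce)+
  show ?thesis
  proof
    assume "L r < i"
    then have "{1..r} \<subseteq> {m. 1 \<le> m \<and> L m < i}" using mono by fastforce
    then show "r \<le> count_below L i"
      using card_mono[OF fin, of "{1..r}"] by (simp add: count_below_def)
  next
    assume le: "r \<le> count_below L i"
    show "L r < i"
    proof (rule ccontr)
      assume "\<not> L r < i"
      then have "m < r" if "L m < i" for m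
        using mono[OF r, of m] that by (cases "m < r") auto
      then have "{m. 1 \<le> m \<and> L m < i} \<subseteq> {1..<r}" by auto
      then have "count_below L i \<le> r - 1"
        using card_mono[of "{1..<r}" "{m. 1 \<le> m \<and> L m < i}"] by (simp add: count_below_def)
      then show False using le r by simp
    qed
  qed
qed

lemma count_below_eqI:
  assumes "L \<in> Delta n" "n \<ge> 1" and "k \<ge> 1 \<Longrightarrow> L k < i" and "i \<le> L (k + 1)"
  shows "count_below L i = k"
proof (rule antisym)
  show "count_below L i \<le> k"
    using le_count_below_iff[OF assms(1,2), of "k + 1" i] assms(4) by simp
  show "k \<le> count_below L i"
    using le_count_below_iff[OF assms(1,2), of k i] assms(3) by (cases "k = 0") auto
qed

text \<open>
  In terms of the counting function the three kinds of rows of \<open>M(L,a) + Y\<close> have one common form.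
  This rests on \<open>j\<close> being a value of \<open>L\<close> exactly if the count jumps after \<open>j\<close>: the jump turns the
  entry \<open>1\<close> of \<open>Y\<close> into \<open>1 + a\<close>, and it separates the exponents in columns \<open>0\<close> and \<open>1\<close>.
\<close>

lemma seq_matrix_plus_shift:
  fixes a :: "'a::field"
  assumes L: "L \<in> Delta n" and n: "n \<ge> 1"
  defines "K \<equiv> count_below L"
  shows "K (Suc j) \<in> {K j, Suc (K j)}"
    and "seq_matrix L a j i + shift_matrix j i =
      (1 / (1 + a)) ^ K (Suc j) * unit_row 0 i - (1 / (1 + a)) ^ K j * unit_row 1 i
      + (1 + a) ^ (K (Suc j) - K j) * unit_row (Suc j) i"
proof -
  note count = count_below_eqI[OF L n, folded K_def]
  have shift: "shift_matrix j i = (unit_row (Suc j) i :: 'a)"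
    by (auto simp: shift_matrix_def unit_row_def)
  note rows = seq_matrix_rows[OF L n]
  have incr: "L k < L (k + 1)" if "k \<ge> 1" for k
    using Delta_less[OF L n, of k "k + 1"] that by simp
  consider "j < L 1" | k where "k \<ge> 1" "L k < j" "j < L (k + 1)" | k where "k \<ge> 1" "j = L k"
    using rows(4)[of j] by blast
  then have "K (Suc j) \<in> {K j, Suc (K j)} \<and> seq_matrix L a j i + shift_matrix j i =
      (1 / (1 + a)) ^ K (Suc j) * unit_row 0 i - (1 / (1 + a)) ^ K j * unit_row 1 i
      + (1 + a) ^ (K (Suc j) - K j) * unit_row (Suc j) i"
  proof cases
    case 1
    then have "K j = 0" "K (Suc j) = 0" using count[of 0] by simp_all
    then show ?thesis using rows(1)[OF 1, of a] shift by simp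
  next
    case (2 k)
    then have "K j = k" "K (Suc j) = k" using count[of k] by simp_all
    then show ?thesis using rows(2)[OF 2, of a] shift by (simp add: algebra_simps)
  next
    case (3 k)
    have "L (k - 1) < j" if "k - 1 \<ge> 1"
      using incr[of "k - 1"] that 3 by simp
    then have "K j = k - 1" using count[of "k - 1" j] 3 by simp
    moreover have "K (Suc j) = k" using count[of k "Suc j"] 3 incr[of k] by simp
    ultimately show ?thesis using 3(1) rows(3)[OF 3, of a] shift 3(2) by (simp add: algebra_simps)
  qed
  then show "K (Suc j) \<in> {K j, Suc (K j)}"
    and "seq_matrix L a j i + shift_matrix j i =
      (1 / (1 + a)) ^ K (Suc j) * unit_row 0 i - (1 / (1 + a)) ^ K j * unit_row 1 i
      + (1 + a) ^ (K (Suc j) - K j) * unit_row (Suc j) i"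
    by blast+
qed

text \<open>
  Row \<open>k \<ge> 1\<close> of \<open>M(L,a) + Y\<close> has entries only in columns \<open>0\<close>, \<open>1\<close> and \<open>k + 1\<close>, so the
  superdiagonal identity relates four powers of \<open>c = 1 + a\<close>; it is multiplied by
  \<open>c ^ K i * c ^ K k * c ^ K (Suc k)\<close>, which removes negative exponents. The restriction to
  \<open>i \<ge> 1\<close> keeps entry \<open>(0, 1)\<close>, which is \<open>0\<close> and not a power of \<open>c\<close>, out of the products.
\<close>

lemma count_below_power_identity:
  fixes c :: "'a::field"
  assumes n: "n \<ge> 1" and c: "c \<noteq> 0" and L: "L \<in> Delta n"
    and M: "is_graded_twisting_matrix (\<lambda>i j. seq_matrix L (c - 1) i j + shift_matrix i j)"
    and i: "i \<ge> 1" and k: "k \<ge> 1"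
  defines "K \<equiv> count_below L"
  shows "c ^ (K (Suc (i + k)) - K (i + k)) * c ^ K i * c ^ K k * c ^ K (Suc k) =
      c ^ K (Suc (i + k)) * c ^ K k - c ^ K (i + k) * c ^ K (Suc k)
      + c ^ (K (Suc k) - K k) * c ^ K i * c ^ K k * c ^ K (Suc k)"
proof -
  define m where "m = (\<lambda>j i. seq_matrix L (c - 1) j i + shift_matrix j i)"
  have entry: "m j i = (1 / c) ^ K (Suc j) * unit_row 0 i - (1 / c) ^ K j * unit_row 1 i
      + c ^ (K (Suc j) - K j) * unit_row (Suc j) i" for j i
    using seq_matrix_plus_shift(2)[OF L n, of "c - 1" j i, folded K_def] by (simp add: m_def)
  have top: "m (i + t) (i + t + 1) = c ^ (K (Suc (i + t)) - K (i + t))" for t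
    using i by (simp add: entry unit_row_def)
  define P where "P r = (\<Prod>t<r. m (i + t) (i + t + 1))" for r
  have P: "P r * c ^ K i = c ^ K (i + r)" for r
  proof (induction r)
    case 0
    show ?case by (simp add: P_def)
  next
    case (Suc r)
    have K_step: "(K (Suc (i + r)) - K (i + r)) + K (i + r) = K (Suc (i + r))"
      using seq_matrix_plus_shift(1)[OF L n, of "i + r", folded K_def] by auto
    have "P (Suc r) * c ^ K i = c ^ (K (Suc (i + r)) - K (i + r)) * (P r * c ^ K i)"
      unfolding P_def prod.lessThan_Suc top by (simp only: ac_simps)
    also have "\<dots> = c ^ K (i + Suc r)"
      unfolding Suc power_add[symmetric] K_step by simp
    finally show ?case .
  qed
  have row: "m k j * P (k + 1 - j) =
      (if j = 0 then (1 / c) ^ K (Suc k) * P (k + 1) else 0)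
      - (if j = 1 then (1 / c) ^ K k * P k else 0)
      + (if j = k + 1 then c ^ (K (Suc k) - K k) * P 0 else 0)" for j
    using k by (simp add: entry unit_row_def)
  have "m (i + k) (i + k + 1) = (\<Sum>j\<le>k + 1. m k j * P (k + 1 - j))"
    unfolding P_def by (rule graded_twisting_matrix_superdiagonal) (use M in \<open>simp only: m_def\<close>)
  also have "\<dots> = (1 / c) ^ K (Suc k) * P (k + 1) - (1 / c) ^ K k * P k
      + c ^ (K (Suc k) - K k) * P 0"
    unfolding row sum.distrib sum_subtractf by simp
  finally have "m (i + k) (i + k + 1) * c ^ K i = (1 / c) ^ K (Suc k) * (P (k + 1) * c ^ K i)
      - (1 / c) ^ K k * (P k * c ^ K i) + c ^ (K (Suc k) - K k) * (P 0 * c ^ K i)"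
    by (simp only: distrib_right left_diff_distrib mult.assoc)
  then have "c ^ (K (Suc (i + k)) - K (i + k)) * c ^ K i =
      c ^ K (Suc (i + k)) / c ^ K (Suc k) - c ^ K (i + k) / c ^ K k
      + c ^ (K (Suc k) - K k) * c ^ K i"
    unfolding P top by (simp add: power_one_over)
  moreover have "x * p * q = u * p - v * q + w * p * q"
    if "x = u / q - v / p + w" "p \<noteq> 0" "q \<noteq> 0" for x p q u v w :: 'a
    unfolding that(1) using that(2,3) by (simp add: distrib_right left_diff_distrib)
  ultimately show ?thesis using c by simp
qed

text \<open>
  As \<open>k\<close> grows by one, the defect \<open>K (i + k) - K i - K k\<close> changes by at most one, and the identity
  excludes the two steps by which it could leave \<open>{0, 1}\<close>.
\<close>

lemma count_below_almost_additive:
  fixes a :: "'a::field"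
  assumes n: "n \<ge> 1" and a: "a \<noteq> 0" "a \<noteq> -1" and L: "L \<in> Delta n"
    and M: "is_graded_twisting_matrix (\<lambda>i j. seq_matrix L a i j + shift_matrix i j)"
    and i: "i \<ge> 1"
  defines "K \<equiv> count_below L"
  shows "K (i + k) \<in> {K i + K k, K i + K k + 1}"
proof (induction k)
  case 0
  show ?case by (simp add: K_def count_below_def)
next
  case (Suc k)
  define c where "c = 1 + a"
  have c: "c \<noteq> 0" "c - 1 \<noteq> 0" "c - 1 = a" using a by (auto simp: c_def add_eq_0_iff)
  have jump: "K (Suc j) \<in> {K j, Suc (K j)}" for j
    unfolding K_def by (rule seq_matrix_plus_shift(1)[OF L n])
  have K01: "K 0 = 0" "K 1 = 0"
    using L n count_below_eqI[OF L n, of 0] by (simp_all add: K_def Delta_def)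
  have rel: "c ^ (K (Suc (i + k)) - K (i + k)) * c ^ K i * c ^ K k * c ^ K (Suc k) =
      c ^ K (Suc (i + k)) * c ^ K k - c ^ K (i + k) * c ^ K (Suc k)
      + c ^ (K (Suc k) - K k) * c ^ K i * c ^ K k * c ^ K (Suc k)" if "k \<ge> 1"
    unfolding K_def
    by (rule count_below_power_identity[OF n c(1) L _ i that]) (simp only: c(3) M)
  have square: False if "c ^ (K i + K k + K k) * ((c - 1) * (c - 1)) = 0"
    using that c by simp
  have not_up: False
    if eqs: "K (i + k) = Suc (K i + K k)" "K (Suc (i + k)) = Suc (Suc (K i + K k))"
      "K (Suc k) = K k"
  proof -
    have "k \<noteq> 0" using K01 eqs(1) by (cases k) simp_all
    then have "c ^ (K i + K k + K k) * ((c - 1) * (c - 1)) = 0"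
      using rel by (simp add: eqs power_add algebra_simps)
    then show False by (rule square)
  qed
  have not_down: False
    if eqs: "K (i + k) = K i + K k" "K (Suc (i + k)) = K i + K k" "K (Suc k) = Suc (K k)"
  proof -
    have "k \<noteq> 0" using K01 eqs(3) by (cases k) simp_all
    then have "c ^ (K i + K k + K k) * ((c - 1) * (c - 1)) = 0"
      using rel by (simp add: eqs power_add algebra_simps)
    then show False by (rule square)
  qed
  from Suc jump[of "i + k"] jump[of k] show ?case
    by (elim insertE emptyE) (use not_up not_down in simp_all)
qed

theorem proposition8p5:
  fixes n :: nat and a :: "'a::field" and L :: "nat \<Rightarrow> nat"
  assumes "n \<ge> 2" and "a \<noteq> 0" and "a \<noteq> -1" and "L \<in> Delta n"
    and "is_graded_twisting_matrix (\<lambda>i j. seq_matrix L a i j + shift_matrix i j)"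
  shows "L \<in> quasi_balanced n"
proof -
  have n: "n \<ge> 1" using assms(1) by simp
  define K where "K = count_below L"
  have iff: "r \<le> K i \<longleftrightarrow> L r < i" if "r \<ge> 1" for r i
    unfolding K_def by (rule le_count_below_iff[OF assms(4) n that])
  have add: "K p + K q \<le> K (p + q) \<and> K (p + q) \<le> K p + K q + 1" if "p \<ge> 1" for p q
    using count_below_almost_additive[OF n assms(2-5) that, of q] by (fastforce simp: K_def)
  have pos: "L m \<ge> 1" if "m \<ge> 1" for m
    using Delta_less[OF assms(4) n, of 1 m] that assms(4) n by (cases "m = 1") (auto simp: Delta_def)
  have bounds: "L r \<le> L j + L (r - j) + 1 \<and> L j + L (r - j) \<le> L r" if "0 < j" "j < r" for r j
  proof
    \<comment> \<open>\<open>L j + 1\<close> is the least argument at which the count reaches \<open>j\<close>.\<close>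
    have "j \<le> K (L j + 1)" "r - j \<le> K (L (r - j) + 1)"
      using that by (simp_all add: iff)
    then have "r \<le> K ((L j + 1) + (L (r - j) + 1))"
      using add[of "L j + 1" "L (r - j) + 1"] that by linarith
    then show "L r \<le> L j + L (r - j) + 1" using that by (simp add: iff)
    have "\<not> j \<le> K (L j)" "\<not> r - j \<le> K (L (r - j))"
      using that by (simp_all add: iff)
    then have "\<not> r \<le> K (L j + L (r - j))"
      using add[of "L j" "L (r - j)"] pos[of j] that by linarith
    then show "L j + L (r - j) \<le> L r" using that by (simp add: iff)
  qed
  have "int (L r) - 1 \<le> int (L j + L (r - j)) \<and> L j + L (r - j) \<le> L r"
    if "0 < j \<and> j < r" for r j
    using bounds[of j r] that by linarith
  then show ?thesis using assms(4) unfolding quasi_balanced_def by blast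
qed

end
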